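(* Let $\langle S,F\rangle$ be an $\mathcal{F}$-system and $A\subseteq S$. Then $A$ is a conglomerate of $\langle S,F\rangle$ if and only if $(A, S\setminus A)$ is a complete and consistent fixed point of $\phi$.
   Context: An $\mathcal{F}$-system is a pair $\langle S, F\rangle$ where $S$ is a set (its elements are called sentences) and $F\subseteq S\times S$ is a binary relation. For $x\in S$ put $\overrightarrow{F}(x)=\{y\in S: (x,y)\in F\}$ and $\overleftarrow{F}(x)=\{y\in S:(y,x)\in F\}$; for $A\subseteq S$ put $\overrightarrow{F}(A)=\bigcup_{x\in A}\overrightarrow{F}(x)$ and $\overleftarrow{F}(A)=\bigcup_{x\in A}\overleftarrow{F}(x)$. A sentence $x$ is a sink if $\overrightarrow{F}(x)=\emptyset$, and $sinks(A)=\{x\in A: x\text{ is a sink}\}$. A conglomerate of $\langle S,F\rangle$ is a subset $A\subseteq S$ such that (1) $\overleftarrow{F}(A)\subseteq S\setminus A$, and (2) $(S\setminus A)\setminus sinks(S)\subseteq\overleftarrow{F}(A)$. For subsets $S^{+},S^{-}\subseteq S$, define $\phi((S^{+},S^{-}))=(S'^{+},S'^{-})$ where $$S'^{+}=sinks(S^{+})\cup\{x\in S:\emptyset\neq\overrightarrow{F}(x)\subseteq S^{-}\},\qquad S'^{-}=sinks(S^{-})\cup\{x\in S:\overrightarrow{F}(x)\cap S^{+}\neq\emptyset\}.$$ A fixed point of $\phi$ is a pair with $(S^{+},S^{-})=\phi((S^{+},S^{-}))$. A pair $(S^{+},S^{-})$ is complete iff every $x\in S$ satisfies $x\in S^{+}\cup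 S^{-}$, and consistent iff $S^{+}\cap S^{-}=\emptyset$. *)

theory Defs
  imports Main
begin

definition F_system :: "'a set \<Rightarrow> 'a rel \<Rightarrow> bool" where
  "F_system S F \<longleftrightarrow> F \<subseteq> S \<times> S"

definition fwd :: "'a set \<Rightarrow> 'a rel \<Rightarrow> 'a \<Rightarrow> 'a set" where
  "fwd S F x = {y \<in> S. (x, y) \<in> F}"

definition bwd :: "'a set \<Rightarrow> 'a rel \<Rightarrow> 'a \<Rightarrow> 'a set" where
  "bwd S F x = {y \<in> S. (y, x) \<in> F}"

definition bwd_set :: "'a set \<Rightarrow> 'a rel \<Rightarrow> 'a set \<Rightarrow> 'a set" where
  "bwd_set S F A = (\<Union>x\<in>A. bwd S F x)"

definition sink :: "'a set \<Rightarrow> 'a rel \<Rightarrow> 'a \<Rightarrow> bool" where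
  "sink S F x \<longleftrightarrow> fwd S F x = {}"

definition sinks :: "'a set \<Rightarrow> 'a rel \<Rightarrow> 'a set \<Rightarrow> 'a set" where
  "sinks S F A = {x \<in> A. sink S F x}"

definition conglomerate :: "'a set \<Rightarrow> 'a rel \<Rightarrow> 'a set \<Rightarrow> bool" where
  "conglomerate S F A \<longleftrightarrow>
     A \<subseteq> S \<and> bwd_set S F A \<subseteq> S - A \<and> (S - A) - sinks S F S \<subseteq> bwd_set S F A"

definition phi :: "'a set \<Rightarrow> 'a rel \<Rightarrow> 'a set \<times> 'a set \<Rightarrow> 'a set \<times> 'a set" where
  "phi S F = (\<lambda>(P, N).
     (sinks S F P \<union> {x \<in> S. fwd S F x \<noteq> {} \<and> fwd S F x \<subseteq> N},
      sinks S F N \<union> {x \<in> S. fwd S F x \<inter> P \<noteq> {}}))"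

text \<open>\<open>phi\<close> is meant as a map on pairs of subsets of \<open>S\<close>, so fixed points are required to lie in
  that domain.\<close>

definition fixed_point :: "'a set \<Rightarrow> 'a rel \<Rightarrow> 'a set \<times> 'a set \<Rightarrow> bool" where
  "fixed_point S F p \<longleftrightarrow> p \<in> Pow S \<times> Pow S \<and> p = phi S F p"

definition complete_pair :: "'a set \<Rightarrow> 'a set \<times> 'a set \<Rightarrow> bool" where
  "complete_pair S = (\<lambda>(P, N). \<forall>x\<in>S. x \<in> P \<union> N)"

definition consistent_pair :: "'a set \<times> 'a set \<Rightarrow> bool" where
  "consistent_pair = (\<lambda>(P, N). P \<inter> N = {})"

end

theory Submission
  imports Defs
begin

text \<open>Both sides amount to one pointwise condition: a non-sink lies in \<open>A\<close>
  exactly when all its successors lie outside \<open>A\<close>. Sinks are unconstrained on either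
  side. \<open>conglomerate_iff\<close> and \<open>fixed_point_complement_iff\<close> give the two
  reductions; completeness and consistency are automatic for complementary sets.\<close>

lemma bwd_set_eq:
  assumes "A \<subseteq> S"
  shows "bwd_set S F A = {x \<in> S. fwd S F x \<inter> A \<noteq> {}}"
  using assms by (auto simp: bwd_set_def bwd_def fwd_def)

text \<open>Clause (1) is the forward implication, and clause (2), read contrapositively, is the
  converse. Sinks satisfy (1) vacuously and are exempt from (2).\<close>

lemma conglomerate_iff:
  assumes "A \<subseteq> S"
  shows "conglomerate S F A \<longleftrightarrow>
    (\<forall>x\<in>S. fwd S F x \<noteq> {} \<longrightarrow> (x \<in> A \<longleftrightarrow> fwd S F x \<subseteq> S - A))"
proof -
  have "fwd S F x \<subseteq> S" for x
    by (auto simp: fwd_def)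
  then have "fwd S F x \<subseteq> S - A \<longleftrightarrow> fwd S F x \<inter> A = {}" for x
    by blast
  then show ?thesis
    using assms by (auto simp: conglomerate_def bwd_set_eq sinks_def sink_def)
qed

text \<open>\<open>phi\<close> leaves sinks in place, so both component equations hold at them. At a
  non-sink the first equation is the stated equivalence and the second is its complement.\<close>

lemma fixed_point_complement_iff:
  assumes "A \<subseteq> S"
  shows "fixed_point S F (A, S - A) \<longleftrightarrow>
    (\<forall>x\<in>S. fwd S F x \<noteq> {} \<longrightarrow> (x \<in> A \<longleftrightarrow> fwd S F x \<subseteq> S - A))"
proof -
  have "fwd S F x \<subseteq> S" for x
    by (auto simp: fwd_def)
  \<comment> \<open>Makes the test in the second component of \<open>phi\<close> the negation of the
    inclusion tested in the first.\<close>
  then have fwd_disjoint: "fwd S F x \<inter> A = {} \<longleftrightarrow> fwd S F x \<subseteq> S - A" for x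
    by blast
  have "fixed_point S F (A, S - A) \<longleftrightarrow>
      A = sinks S F A \<union> {x \<in> S. fwd S F x \<noteq> {} \<and> fwd S F x \<subseteq> S - A} \<and>
      S - A = sinks S F (S - A) \<union> {x \<in> S. \<not> fwd S F x \<subseteq> S - A}"
    using assms by (simp add: fixed_point_def phi_def fwd_disjoint)
  also have "\<dots> \<longleftrightarrow> (\<forall>x\<in>S. fwd S F x \<noteq> {} \<longrightarrow> (x \<in> A \<longleftrightarrow> fwd S F x \<subseteq> S - A))"
    \<comment> \<open>Instantiating \<open>set_eq_iff\<close> makes only the two component equations
      pointwise and leaves the sink tests \<open>fwd S F x = {}\<close> intact.\<close>
    using assms unfolding sinks_def sink_def set_eq_iff[of A] set_eq_iff[of "S - A"]
    by blast
  finally show ?thesis .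
qed

theorem theorem2:
  fixes S :: "'a set" and F :: "'a rel" and A :: "'a set"
  assumes "F_system S F" and "A \<subseteq> S"
  shows "conglomerate S F A \<longleftrightarrow>
    fixed_point S F (A, S - A) \<and> complete_pair S (A, S - A) \<and> consistent_pair (A, S - A)"
  using assms(2)
  by (auto simp: conglomerate_iff fixed_point_complement_iff complete_pair_def consistent_pair_def)

end
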